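(* Let $A$ be a valid axiomatization of a proposition/term language $L$ capable of reproducing gradualist number theory. Then for each $n$, there is a program of length $O(\log n)$ encoding an algorithm that succeeds at computing the largest number which is the output of some algorithm $\alpha$ for which there is a proof in $A$ of length at most $n$ that $\alpha$ halts. This program can be written explicitly.
   Context: Programs are written in a fixed programming language. An axiomatization $A$ of a formal language $L$ is a finite list of axiom schemas and inference rules; a proof in $A$ is a finite list of proof steps built according to a fixed natural-deduction-style system, so that whether a string is a proof in $A$ (and of what) is algorithmically checkable. The length of a proof is the sum of the lengths (numbers of symbols) of its steps. $L$ "capable of reproducing gradualist number theory" means $L$ can interpret the natural numbers with $0,1,+,\times$, exponentiation, $=,<$, bounded quantifiers, unbounded existential quantifiers and the least-number operator; in particular statements "the algorithm $\alpha$ halts" are expressible in $L$. $A$ is valid if what it proves is true; in particular, whenever $A$ proves that an algorithm halts, that algorithm does halt. *)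

theory Defs
  imports Complex_Main "HOL-Library.Landau_Symbols"
begin

section \<open>The programming language\<close>

text \<open>
  A small point-free language in the style of Backus' FP, with unbounded loops. Data are binary
  trees with numbers at the leaves, and a program denotes a partial function on data. The
  conventions for ill-typed arguments (a leaf has components 0; a tree counts as 0 in arithmetic)
  make every primitive total, so that looping is the only way not to halt.
\<close>

datatype data = Num nat | Pr data data

datatype prog =
    Skip
  | Quote data
  | Tuple prog prog
  | Fst
  | Snd
  | Add
  | Sub
  | Equal
  | IsNum
  | Seq prog prog
  | Cond prog prog prog
  | While prog prog

fun left :: "data \<Rightarrow> data" where
  "left (Num n) = Num 0"
| "left (Pr u v) = u"

fun right :: "data \<Rightarrow> data" where
  "right (Num n) = Num 0"
| "right (Pr u v) = v"

fun num_of :: "data \<Rightarrow> nat" where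
  "num_of (Num n) = n"
| "num_of (Pr u v) = 0"

definition truth :: "bool \<Rightarrow> data" where
  "truth b = Num (of_bool b)"

inductive exec :: "prog \<Rightarrow> data \<Rightarrow> data \<Rightarrow> bool" where
  exec_Skip: "exec Skip v v"
| exec_Quote: "exec (Quote c) v c"
| exec_Tuple: "exec p v a \<Longrightarrow> exec q v b \<Longrightarrow> exec (Tuple p q) v (Pr a b)"
| exec_Fst: "exec Fst v (left v)"
| exec_Snd: "exec Snd v (right v)"
| exec_Add: "exec Add v (Num (num_of (left v) + num_of (right v)))"
| exec_Sub: "exec Sub v (Num (num_of (left v) - num_of (right v)))"
| exec_Equal: "exec Equal v (truth (left v = right v))"
| exec_IsNum: "exec IsNum v (truth (\<exists>n. v = Num n))"
| exec_Seq: "exec p v a \<Longrightarrow> exec q a b \<Longrightarrow> exec (Seq p q) v b"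
| exec_Cond_true: "exec c v a \<Longrightarrow> a \<noteq> Num 0 \<Longrightarrow> exec p v b \<Longrightarrow> exec (Cond c p q) v b"
| exec_Cond_false: "exec c v (Num 0) \<Longrightarrow> exec q v b \<Longrightarrow> exec (Cond c p q) v b"
| exec_While_stop: "exec c v (Num 0) \<Longrightarrow> exec (While c p) v v"
| exec_While_step:
    "exec c v a \<Longrightarrow> a \<noteq> Num 0 \<Longrightarrow> exec p v u \<Longrightarrow> exec (While c p) u w \<Longrightarrow> exec (While c p) v w"

text \<open>An algorithm without input is a program started on the dummy input \<open>Num 0\<close>.\<close>

definition halts :: "prog \<Rightarrow> bool" where
  "halts p \<longleftrightarrow> (\<exists>v. exec p (Num 0) v)"

definition outputs :: "prog \<Rightarrow> nat \<Rightarrow> bool" where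
  "outputs p m \<longleftrightarrow> exec p (Num 0) (Num m)"

text \<open>
  The length of a program is the number of characters of its text, in which numbers are written
  in binary.
\<close>

fun binary :: "nat \<Rightarrow> string" where
  "binary n =
    (if n < 2 then [] else binary (n div 2)) @ (if even n then ''0'' else ''1'')"

declare binary.simps [simp del]

primrec data_text :: "data \<Rightarrow> string" where
  "data_text (Num n) = binary n"
| "data_text (Pr u v) = ''['' @ data_text u @ '','' @ data_text v @ '']''"

primrec prog_text :: "prog \<Rightarrow> string" where
  "prog_text Skip = ''skip''"
| "prog_text (Quote c) = data_text c"
| "prog_text (Tuple p q) = ''<'' @ prog_text p @ '','' @ prog_text q @ ''>''"
| "prog_text Fst = ''fst''"
| "prog_text Snd = ''snd''"
| "prog_text Add = ''add''"
| "prog_text Sub = ''sub''"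
| "prog_text Equal = ''eq''"
| "prog_text IsNum = ''num''"
| "prog_text (Seq p q) = ''('' @ prog_text p @ '';'' @ prog_text q @ '')''"
| "prog_text (Cond c p q) =
    ''if('' @ prog_text c @ '','' @ prog_text p @ '','' @ prog_text q @ '')''"
| "prog_text (While c p) = ''while('' @ prog_text c @ '','' @ prog_text p @ '')''"

definition prog_length :: "prog \<Rightarrow> nat" where
  "prog_length p = length (prog_text p)"

text \<open>
  Programs, strings, etc. as data. No program is coded by a leaf.
\<close>

primrec prog_code :: "prog \<Rightarrow> data" where
  "prog_code Skip = Pr (Num 0) (Num 0)"
| "prog_code (Quote c) = Pr (Num 1) c"
| "prog_code (Tuple p q) = Pr (Num 2) (Pr (prog_code p) (prog_code q))"
| "prog_code Fst = Pr (Num 3) (Num 0)"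
| "prog_code Snd = Pr (Num 4) (Num 0)"
| "prog_code Add = Pr (Num 5) (Num 0)"
| "prog_code Sub = Pr (Num 6) (Num 0)"
| "prog_code Equal = Pr (Num 7) (Num 0)"
| "prog_code IsNum = Pr (Num 8) (Num 0)"
| "prog_code (Seq p q) = Pr (Num 9) (Pr (prog_code p) (prog_code q))"
| "prog_code (Cond c p q) = Pr (Num 10) (Pr (prog_code c) (Pr (prog_code p) (prog_code q)))"
| "prog_code (While c p) = Pr (Num 11) (Pr (prog_code c) (prog_code p))"

primrec list_code :: "('a \<Rightarrow> data) \<Rightarrow> 'a list \<Rightarrow> data" where
  "list_code f [] = Num 0"
| "list_code f (x # xs) = Pr (f x) (list_code f xs)"

definition accepts :: "prog \<Rightarrow> data \<Rightarrow> bool" where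
  "accepts p v \<longleftrightarrow> exec p v (Num 1)"

definition decider :: "prog \<Rightarrow> bool" where
  "decider p \<longleftrightarrow> (\<forall>v. exec p v (Num 0) \<or> exec p v (Num 1))"

section \<open>Formal languages\<close>

text \<open>
  The symbols of a language are the numbers below \<open>alphabet\<close>. Its propositions and its terms are
  the strings recognised by two decision procedures. It comes with its intended meaning: which
  propositions hold, and which object, if any, a term denotes.
\<close>

type_synonym expr = "nat list"

definition expr_code :: "expr \<Rightarrow> data" where
  "expr_code = list_code Num"

record 'd formal_language =
  alphabet :: nat
  prop_test :: prog
  term_test :: prog
  holds :: "expr \<Rightarrow> bool"
  denotation :: "expr \<Rightarrow> 'd option"

definition propositions :: "'d formal_language \<Rightarrow> expr set" where
  "propositions L = {s. accepts (prop_test L) (expr_code s)}"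

definition lterms :: "'d formal_language \<Rightarrow> expr set" where
  "lterms L = {s. accepts (term_test L) (expr_code s)}"

definition formal_language :: "'d formal_language \<Rightarrow> bool" where
  "formal_language L \<longleftrightarrow>
     decider (prop_test L) \<and> decider (term_test L) \<and>
     propositions L \<subseteq> lists {..<alphabet L} \<and> lterms L \<subseteq> lists {..<alphabet L}"

section \<open>Axiomatizations and proofs\<close>

text \<open>
  Natural deduction in sequent form: a proof step \<open>(\<Gamma>, \<phi>)\<close> asserts \<open>\<phi>\<close> under the open
  hypotheses \<open>\<Gamma>\<close>. An axiom schema is presented by a program recognising its instances, and an
  inference rule by its number of premises and a program recognising the pairs of a list of premises
  and a conclusion. As rules act on steps including their hypotheses, they may discharge
  hypotheses and may impose eigenvariable conditions.
\<close>

type_synonym step = "expr list \<times> expr"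

definition step_code :: "step \<Rightarrow> data" where
  "step_code s = Pr (list_code expr_code (fst s)) (expr_code (snd s))"

record axiom_system =
  schemas :: "prog list"
  rules :: "(nat \<times> prog) list"

definition axiom_system :: "axiom_system \<Rightarrow> bool" where
  "axiom_system A \<longleftrightarrow>
     (\<forall>p \<in> set (schemas A). decider p) \<and> (\<forall>(k, p) \<in> set (rules A). decider p)"

definition correct_step ::
  "'d formal_language \<Rightarrow> axiom_system \<Rightarrow> step list \<Rightarrow> step \<Rightarrow> bool" where
  "correct_step L A earlier s \<longleftrightarrow>
     set (fst s) \<subseteq> propositions L \<and> snd s \<in> propositions L \<and>
     (snd s \<in> set (fst s) \<or>
      (\<exists>p \<in> set (schemas A). accepts p (expr_code (snd s))) \<or>
      (\<exists>(k, p) \<in> set (rules A). \<exists>prems.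
         length prems = k \<and> set prems \<subseteq> set earlier \<and>
         accepts p (Pr (list_code step_code prems) (step_code s))))"

definition is_proof_of ::
  "'d formal_language \<Rightarrow> axiom_system \<Rightarrow> step list \<Rightarrow> expr \<Rightarrow> bool" where
  "is_proof_of L A ss \<phi> \<longleftrightarrow>
     (\<forall>i < length ss. correct_step L A (take i ss) (ss ! i)) \<and>
     ss \<noteq> [] \<and> last ss = ([], \<phi>)"

text \<open>
  In a written step every hypothesis is followed by a separator, and the conclusion is preceded by
  a turnstile.
\<close>

definition step_length :: "step \<Rightarrow> nat" where
  "step_length s = (\<Sum>\<gamma>\<leftarrow>fst s. length \<gamma> + 1) + 1 + length (snd s)"

definition proof_length :: "step list \<Rightarrow> nat" where
  "proof_length ss = (\<Sum>s\<leftarrow>ss. step_length s)"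

definition valid_system :: "'d formal_language \<Rightarrow> axiom_system \<Rightarrow> bool" where
  "valid_system L A \<longleftrightarrow> (\<forall>ss \<phi>. is_proof_of L A ss \<phi> \<longrightarrow> holds L \<phi>)"

section \<open>Gradualist number theory\<close>

datatype gterm =
    GVar nat
  | GZero
  | GOne
  | GPlus gterm gterm
  | GTimes gterm gterm
  | GPower gterm gterm
  | GLeast nat gform
and gform =
    GEq gterm gterm
  | GLess gterm gterm
  | GNot gform
  | GAnd gform gform
  | GOr gform gform
  | GAllLess nat gterm gform
  | GExLess nat gterm gform
  | GEx nat gform

text \<open>
  Terms may be undefined because of the least-number operator. Atomic formulas with an undefined
  term, and bounded quantifications with an undefined bound, are not true.
\<close>

definition lift2 :: "(nat \<Rightarrow> nat \<Rightarrow> nat) \<Rightarrow> nat option \<Rightarrow> nat option \<Rightarrow> nat option" where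
  "lift2 f a b = Option.bind a (\<lambda>x. Option.bind b (\<lambda>y. Some (f x y)))"

primrec gval :: "gterm \<Rightarrow> (nat \<Rightarrow> nat) \<Rightarrow> nat option"
  and gsat :: "gform \<Rightarrow> (nat \<Rightarrow> nat) \<Rightarrow> bool" where
  "gval (GVar x) e = Some (e x)"
| "gval GZero e = Some 0"
| "gval GOne e = Some 1"
| "gval (GPlus s t) e = lift2 (+) (gval s e) (gval t e)"
| "gval (GTimes s t) e = lift2 (*) (gval s e) (gval t e)"
| "gval (GPower s t) e = lift2 (^) (gval s e) (gval t e)"
| "gval (GLeast x \<phi>) e =
     (if \<exists>n. gsat \<phi> (e(x := n)) then Some (LEAST n. gsat \<phi> (e(x := n))) else None)"
| "gsat (GEq s t) e \<longleftrightarrow> (\<exists>a b. gval s e = Some a \<and> gval t e = Some b \<and> a = b)"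
| "gsat (GLess s t) e \<longleftrightarrow> (\<exists>a b. gval s e = Some a \<and> gval t e = Some b \<and> a < b)"
| "gsat (GNot \<phi>) e \<longleftrightarrow> \<not> gsat \<phi> e"
| "gsat (GAnd \<phi> \<psi>) e \<longleftrightarrow> gsat \<phi> e \<and> gsat \<psi> e"
| "gsat (GOr \<phi> \<psi>) e \<longleftrightarrow> gsat \<phi> e \<or> gsat \<psi> e"
| "gsat (GAllLess x t \<phi>) e \<longleftrightarrow> (\<exists>b. gval t e = Some b \<and> (\<forall>n<b. gsat \<phi> (e(x := n))))"
| "gsat (GExLess x t \<phi>) e \<longleftrightarrow> (\<exists>b. gval t e = Some b \<and> (\<exists>n<b. gsat \<phi> (e(x := n))))"
| "gsat (GEx x \<phi>) e \<longleftrightarrow> (\<exists>n. gsat \<phi> (e(x := n)))"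

primrec gterm_fv :: "gterm \<Rightarrow> nat set"
  and gform_fv :: "gform \<Rightarrow> nat set" where
  "gterm_fv (GVar x) = {x}"
| "gterm_fv GZero = {}"
| "gterm_fv GOne = {}"
| "gterm_fv (GPlus s t) = gterm_fv s \<union> gterm_fv t"
| "gterm_fv (GTimes s t) = gterm_fv s \<union> gterm_fv t"
| "gterm_fv (GPower s t) = gterm_fv s \<union> gterm_fv t"
| "gterm_fv (GLeast x \<phi>) = gform_fv \<phi> - {x}"
| "gform_fv (GEq s t) = gterm_fv s \<union> gterm_fv t"
| "gform_fv (GLess s t) = gterm_fv s \<union> gterm_fv t"
| "gform_fv (GNot \<phi>) = gform_fv \<phi>"
| "gform_fv (GAnd \<phi> \<psi>) = gform_fv \<phi> \<union> gform_fv \<psi>"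
| "gform_fv (GOr \<phi> \<psi>) = gform_fv \<phi> \<union> gform_fv \<psi>"
| "gform_fv (GAllLess x t \<phi>) = gterm_fv t \<union> (gform_fv \<phi> - {x})"
| "gform_fv (GExLess x t \<phi>) = gterm_fv t \<union> (gform_fv \<phi> - {x})"
| "gform_fv (GEx x \<phi>) = gform_fv \<phi> - {x}"

text \<open>
  There are no unbounded universal quantifiers. So that they do not come back as a negated
  existential quantifier, or through the minimality clause of the least-number operator, negation and
  the least-number operator apply to bounded formulas only, that is, to those without unbounded
  quantifier and without least-number operator.
\<close>

primrec bounded_gterm :: "gterm \<Rightarrow> bool"
  and bounded_gform :: "gform \<Rightarrow> bool" where
  "bounded_gterm (GVar x) \<longleftrightarrow> True"
| "bounded_gterm GZero \<longleftrightarrow> True"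
| "bounded_gterm GOne \<longleftrightarrow> True"
| "bounded_gterm (GPlus s t) \<longleftrightarrow> bounded_gterm s \<and> bounded_gterm t"
| "bounded_gterm (GTimes s t) \<longleftrightarrow> bounded_gterm s \<and> bounded_gterm t"
| "bounded_gterm (GPower s t) \<longleftrightarrow> bounded_gterm s \<and> bounded_gterm t"
| "bounded_gterm (GLeast x \<phi>) \<longleftrightarrow> False"
| "bounded_gform (GEq s t) \<longleftrightarrow> bounded_gterm s \<and> bounded_gterm t"
| "bounded_gform (GLess s t) \<longleftrightarrow> bounded_gterm s \<and> bounded_gterm t"
| "bounded_gform (GNot \<phi>) \<longleftrightarrow> bounded_gform \<phi>"
| "bounded_gform (GAnd \<phi> \<psi>) \<longleftrightarrow> bounded_gform \<phi> \<and> bounded_gform \<psi>"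
| "bounded_gform (GOr \<phi> \<psi>) \<longleftrightarrow> bounded_gform \<phi> \<and> bounded_gform \<psi>"
| "bounded_gform (GAllLess x t \<phi>) \<longleftrightarrow> bounded_gterm t \<and> bounded_gform \<phi>"
| "bounded_gform (GExLess x t \<phi>) \<longleftrightarrow> bounded_gterm t \<and> bounded_gform \<phi>"
| "bounded_gform (GEx x \<phi>) \<longleftrightarrow> False"

primrec wf_gterm :: "gterm \<Rightarrow> bool"
  and wf_gform :: "gform \<Rightarrow> bool" where
  "wf_gterm (GVar x) \<longleftrightarrow> True"
| "wf_gterm GZero \<longleftrightarrow> True"
| "wf_gterm GOne \<longleftrightarrow> True"
| "wf_gterm (GPlus s t) \<longleftrightarrow> wf_gterm s \<and> wf_gterm t"
| "wf_gterm (GTimes s t) \<longleftrightarrow> wf_gterm s \<and> wf_gterm t"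
| "wf_gterm (GPower s t) \<longleftrightarrow> wf_gterm s \<and> wf_gterm t"
| "wf_gterm (GLeast x \<phi>) \<longleftrightarrow> bounded_gform \<phi>"
| "wf_gform (GEq s t) \<longleftrightarrow> wf_gterm s \<and> wf_gterm t"
| "wf_gform (GLess s t) \<longleftrightarrow> wf_gterm s \<and> wf_gterm t"
| "wf_gform (GNot \<phi>) \<longleftrightarrow> bounded_gform \<phi>"
| "wf_gform (GAnd \<phi> \<psi>) \<longleftrightarrow> wf_gform \<phi> \<and> wf_gform \<psi>"
| "wf_gform (GOr \<phi> \<psi>) \<longleftrightarrow> wf_gform \<phi> \<and> wf_gform \<psi>"
| "wf_gform (GAllLess x t \<phi>) \<longleftrightarrow> wf_gterm t \<and> wf_gform \<phi>"
| "wf_gform (GExLess x t \<phi>) \<longleftrightarrow> wf_gterm t \<and> wf_gform \<phi>"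
| "wf_gform (GEx x \<phi>) \<longleftrightarrow> wf_gform \<phi>"

definition closed_gterms :: "gterm set" where
  "closed_gterms = {t. wf_gterm t \<and> gterm_fv t = {}}"

definition gsentences :: "gform set" where
  "gsentences = {\<phi>. wf_gform \<phi> \<and> gform_fv \<phi> = {}}"

definition gtrue :: "gform \<Rightarrow> bool" where
  "gtrue \<phi> \<longleftrightarrow> gsat \<phi> (\<lambda>_. 0)"

text \<open>
  The translations \<open>T\<close> of closed terms and \<open>F\<close> of sentences interpret gradualist number
  theory in \<open>L\<close>, the number \<open>n\<close> being the object \<open>\<nu> n\<close>.
\<close>

definition interprets_gnt ::
  "'d formal_language \<Rightarrow> (nat \<Rightarrow> 'd) \<Rightarrow> (gterm \<Rightarrow> expr) \<Rightarrow> (gform \<Rightarrow> expr) \<Rightarrow> bool" where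
  "interprets_gnt L \<nu> T F \<longleftrightarrow>
     inj \<nu> \<and>
     (\<forall>t \<in> closed_gterms. T t \<in> lterms L \<and>
        denotation L (T t) = map_option \<nu> (gval t (\<lambda>_. 0))) \<and>
     (\<forall>\<phi> \<in> gsentences. F \<phi> \<in> propositions L \<and> (holds L (F \<phi>) \<longleftrightarrow> gtrue \<phi>))"

text \<open>
  \<open>H \<alpha>\<close> is the number-theoretic sentence saying that the algorithm \<open>\<alpha>\<close> halts, and \<open>F (H \<alpha>)\<close>
  its rendering in \<open>L\<close>. The program \<open>rd\<close> tells of which algorithm, if any, a proposition
  says that it halts; in particular \<open>F (H \<alpha>)\<close> determines \<open>\<alpha>\<close>.
\<close>

definition expresses_halting :: "(prog \<Rightarrow> gform) \<Rightarrow> bool" where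
  "expresses_halting H \<longleftrightarrow> (\<forall>\<alpha>. H \<alpha> \<in> gsentences \<and> (gtrue (H \<alpha>) \<longleftrightarrow> halts \<alpha>))"

definition reads_halting ::
  "'d formal_language \<Rightarrow> (prog \<Rightarrow> expr) \<Rightarrow> prog \<Rightarrow> bool" where
  "reads_halting L hs rd \<longleftrightarrow>
     (\<forall>\<alpha>. exec rd (expr_code (hs \<alpha>)) (prog_code \<alpha>)) \<and>
     (\<forall>s \<in> propositions L - range hs. exec rd (expr_code s) (Num 0))"

definition provable_outputs ::
  "'d formal_language \<Rightarrow> axiom_system \<Rightarrow> (prog \<Rightarrow> expr) \<Rightarrow> nat \<Rightarrow> nat set" where
  "provable_outputs L A hs n =
     {m. \<exists>\<alpha> ss. is_proof_of L A ss (hs \<alpha>) \<and> proof_length ss \<le> n \<and> outputs \<alpha> m}"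

text \<open>The finite description of \<open>L\<close> and \<open>A\<close> from which a program can be written down.\<close>

definition description :: "'d formal_language \<Rightarrow> axiom_system \<Rightarrow> prog \<Rightarrow> data" where
  "description L A rd =
     Pr (Pr (Num (alphabet L)) (Pr (prog_code (prop_test L)) (prog_code (term_test L))))
       (Pr (Pr (list_code prog_code (schemas A))
               (list_code (\<lambda>(k, p). Pr (Num k) (prog_code p)) (rules A)))
           (prog_code rd))"

end

theory Submission
  imports Defs
begin

text \<open>
  The program quotes the description of \<open>L\<close> and \<open>A\<close> together with \<open>n\<close>, and passes them to a fixed
  program; only the binary notation of \<open>n\<close> varies, whence the length \<open>O(ln n)\<close>. The fixed program
  enumerates the finitely many proofs of length at most \<open>n\<close>, runs every algorithm that one of them
  proves to halt, and keeps the largest output. Validity of \<open>A\<close> is what makes this terminate: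
  only algorithms that really halt are ever run. As these algorithms and the deciders of \<open>L\<close> and
  \<open>A\<close> are given by their codes, the fixed program contains a self-interpreter.
\<close>

section \<open>Determinism and loop-free programs\<close>

text \<open>Gives uniqueness twice later on: the reader assigns at most one algorithm to a sentence,
  and an algorithm has at most one output.\<close>

lemma exec_deterministic: "exec p v a \<Longrightarrow> exec p v b \<Longrightarrow> a = b"
proof (induction arbitrary: b rule: exec.induct)
  case (exec_Tuple p v a q b c)
  from exec_Tuple.prems show ?case
    by (cases rule: exec.cases) (use exec_Tuple.IH in \<open>blast+\<close>)
next
  case (exec_Seq p v a q b c)
  from exec_Seq.prems show ?case
    by (cases rule: exec.cases) (use exec_Seq.IH in \<open>blast+\<close>)
next
  case (exec_Cond_true c v a p b q d)
  from exec_Cond_true.prems show ?case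
    by (cases rule: exec.cases) (use exec_Cond_true in \<open>blast+\<close>)
next
  case (exec_Cond_false c v q b p d)
  from exec_Cond_false.prems show ?case
    by (cases rule: exec.cases) (use exec_Cond_false in \<open>blast+\<close>)
next
  case (exec_While_stop c v p d)
  from exec_While_stop.prems show ?case
    by (cases rule: exec.cases) (use exec_While_stop in \<open>blast+\<close>)
next
  case (exec_While_step c v a p u w d)
  from exec_While_step.prems show ?case
    by (cases rule: exec.cases) (use exec_While_step in \<open>blast+\<close>)
qed (auto elim: exec.cases)

lemma exec_accepts:
  assumes "decider p"
  shows "exec p v (truth (accepts p v))"
  using assms unfolding decider_def accepts_def truth_def
  by (cases "exec p v (Num 1)") auto

primrec loop_free :: "prog \<Rightarrow> bool" where
  "loop_free Skip \<longleftrightarrow> True"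
| "loop_free (Quote c) \<longleftrightarrow> True"
| "loop_free (Tuple p q) \<longleftrightarrow> loop_free p \<and> loop_free q"
| "loop_free Fst \<longleftrightarrow> True"
| "loop_free Snd \<longleftrightarrow> True"
| "loop_free Add \<longleftrightarrow> True"
| "loop_free Sub \<longleftrightarrow> True"
| "loop_free Equal \<longleftrightarrow> True"
| "loop_free IsNum \<longleftrightarrow> True"
| "loop_free (Seq p q) \<longleftrightarrow> loop_free p \<and> loop_free q"
| "loop_free (Cond c p q) \<longleftrightarrow> loop_free c \<and> loop_free p \<and> loop_free q"
| "loop_free (While c p) \<longleftrightarrow> False"

text \<open>Makes executions of loop-free fragments a matter of rewriting, by way of
  \<open>exec_loop_free\<close>. The clause for \<open>While\<close> is a dummy.\<close>

primrec run :: "prog \<Rightarrow> data \<Rightarrow> data" where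
  "run Skip v = v"
| "run (Quote c) v = c"
| "run (Tuple p q) v = Pr (run p v) (run q v)"
| "run Fst v = left v"
| "run Snd v = right v"
| "run Add v = Num (num_of (left v) + num_of (right v))"
| "run Sub v = Num (num_of (left v) - num_of (right v))"
| "run Equal v = truth (left v = right v)"
| "run IsNum v = truth (\<exists>n. v = Num n)"
| "run (Seq p q) v = run q (run p v)"
| "run (Cond c p q) v = (if run c v = Num 0 then run q v else run p v)"
| "run (While c p) v = v"

lemma exec_run: "loop_free p \<Longrightarrow> exec p v (run p v)"
  by (induction p arbitrary: v) (auto intro: exec.intros, metis exec_Cond_false)

lemma exec_loop_free: "loop_free p \<Longrightarrow> run p v = w \<Longrightarrow> exec p v w"
  using exec_run by blast

lemma truth_simps [simp]:
  "truth True = Num 1" "truth False = Num 0" "truth b = Num 0 \<longleftrightarrow> \<not> b"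
  by (auto simp: truth_def)

section \<open>A self-interpreter\<close>

text \<open>Dispatches on the tag of the topmost instruction, which is three times to the left in
  the state; \<open>k\<close> is the tag handled by the head of the list.\<close>

primrec switch :: "nat \<Rightarrow> prog list \<Rightarrow> prog" where
  "switch k [] = Skip"
| "switch k (p # ps) =
    Cond (Seq (Tuple (Seq Fst (Seq Fst Fst)) (Quote (Num k))) Equal) p (switch (Suc k) ps)"

lemma loop_free_switch: "loop_free (switch k ps) \<longleftrightarrow> list_all loop_free ps"
  by (induction ps arbitrary: k) auto

lemma run_switch:
  "j < length ps \<Longrightarrow>
    run (switch k ps) (Pr (Pr (Pr (Num (k + j)) x) K) v) = run (ps ! j) (Pr (Pr (Pr (Num (k + j)) x) K) v)"
proof (induction ps arbitrary: k j)
  case (Cons p ps)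
  show ?case
  proof (cases j)
    case (Suc i)
    with Cons.IH[of i "Suc k"] Cons.prems show ?thesis by simp
  qed simp
qed simp

text \<open>
  A state \<open>Pr K v\<close> of the interpreter consists of a stack \<open>K\<close> of instructions and the current
  value \<open>v\<close>. Instructions are codes of programs, and three continuations: with tag 12, run the
  second component of a tuple on the saved input; with tag 13, form the pair with the saved
  first component; with tag 14, choose the branch of a conditional.
\<close>

abbreviation (input) "arg_prog \<equiv> Seq Fst (Seq Fst Snd)"
abbreviation (input) "stack_prog \<equiv> Seq Fst Snd"

text \<open>Entry \<open>j\<close> handles tag \<open>j\<close>. Entry 11 unfolds
  \<open>While c p\<close> to \<open>Cond c (Seq p (While c p)) Skip\<close>, copying the code of
  the loop from the top of the stack.\<close>

definition instructions :: "prog list" where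
  "instructions =
    [Tuple stack_prog Snd,
     Tuple stack_prog arg_prog,
     Tuple
       (Tuple (Seq arg_prog Fst)
         (Tuple (Tuple (Quote (Num 12)) (Tuple (Seq arg_prog Snd) Snd)) stack_prog))
       Snd,
     Tuple stack_prog (Seq Snd Fst),
     Tuple stack_prog (Seq Snd Snd),
     Tuple stack_prog (Seq Snd Add),
     Tuple stack_prog (Seq Snd Sub),
     Tuple stack_prog (Seq Snd Equal),
     Tuple stack_prog (Seq Snd IsNum),
     Tuple (Tuple (Seq arg_prog Fst) (Tuple (Seq arg_prog Snd) stack_prog)) Snd,
     Tuple
       (Tuple (Seq arg_prog Fst)
         (Tuple (Tuple (Quote (Num 14)) (Tuple Snd (Seq arg_prog Snd))) stack_prog))
       Snd,
     Tuple
       (Tuple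
         (Tuple (Quote (Num 10))
           (Tuple (Seq arg_prog Fst)
             (Tuple
               (Tuple (Quote (Num 9)) (Tuple (Seq arg_prog Snd) (Seq Fst Fst)))
               (Quote (prog_code Skip)))))
         stack_prog)
       Snd,
     Tuple
       (Tuple (Seq arg_prog Fst) (Tuple (Tuple (Quote (Num 13)) Snd) stack_prog))
       (Seq arg_prog Snd),
     Tuple stack_prog (Tuple arg_prog Snd),
     Tuple
       (Tuple (Cond Snd (Seq arg_prog (Seq Snd Fst)) (Seq arg_prog (Seq Snd Snd))) stack_prog)
       (Seq arg_prog Fst)]"

definition interpreter_step :: prog where
  "interpreter_step = switch 0 instructions"

lemma loop_free_interpreter_step: "loop_free interpreter_step"
  by (simp add: interpreter_step_def instructions_def loop_free_switch)

definition is_pair :: prog where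
  "is_pair = Seq (Tuple IsNum (Quote (Num 0))) Equal"

lemma loop_free_is_pair [simp]: "loop_free is_pair"
  by (simp add: is_pair_def)

lemma run_is_pair [simp]: "run is_pair (Pr a b) = Num 1" "run is_pair (Num n) = Num 0"
  by (auto simp: is_pair_def)

text \<open>The empty stack is a leaf and a nonempty one a pair, so the guard asks whether an
  instruction is pending.\<close>

definition interpreter_loop :: prog where
  "interpreter_loop = While (Seq Fst is_pair) interpreter_step"

definition interpreter :: prog where
  "interpreter = Seq (Tuple (Tuple Fst (Quote (Num 0))) Snd) (Seq interpreter_loop Snd)"

lemma interpreter_loop_step:
  assumes "j < length instructions"
    and "exec interpreter_loop (run (instructions ! j) (Pr (Pr (Pr (Num j) x) K) v)) u"
  shows "exec interpreter_loop (Pr (Pr (Pr (Num j) x) K) v) u"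
  unfolding interpreter_loop_def
proof (rule exec_While_step)
  let ?s = "Pr (Pr (Pr (Num j) x) K) v"
  show "exec (Seq Fst is_pair) ?s (Num 1)"
    by (rule exec_loop_free) auto
  show "exec interpreter_step ?s (run (instructions ! j) ?s)"
    using run_switch[OF assms(1), of 0] loop_free_interpreter_step
    by (intro exec_loop_free) (auto simp: interpreter_step_def)
  show "exec (While (Seq Fst is_pair) interpreter_step) (run (instructions ! j) ?s) u"
    using assms(2) unfolding interpreter_loop_def .
qed simp

lemmas interpret_instruction = interpreter_loop_step[unfolded instructions_def]

text \<open>Induction needs an arbitrary rest \<open>K\<close> of the stack, since subprograms run
  on top of continuations left by the enclosing program. Each case is traced backwards, from the
  state with the result to the state with the code.\<close>

lemma interpreter_loop_exec:
  "exec p v w \<Longrightarrow> exec interpreter_loop (Pr K w) u \<Longrightarrow>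
    exec interpreter_loop (Pr (Pr (prog_code p) K) v) u"
proof (induction arbitrary: K rule: exec.induct)
  case (exec_Tuple p v a q b)
  have "exec interpreter_loop (Pr (Pr (Pr (Num 13) a) K) b) u"
    by (intro interpret_instruction) (simp_all add: exec_Tuple.prems)
  then have "exec interpreter_loop (Pr (Pr (Pr (Num 12) (Pr (prog_code q) v)) K) a) u"
    by (intro interpret_instruction) (simp_all add: exec_Tuple.IH)
  then show ?case
    unfolding prog_code.simps by (intro interpret_instruction) (simp_all add: exec_Tuple.IH)
next
  case (exec_Seq p v a q b)
  show ?case
    unfolding prog_code.simps by (intro interpret_instruction) (simp_all add: exec_Seq)
next
  case (exec_Cond_true c v a p b q)
  have "exec interpreter_loop
      (Pr (Pr (Pr (Num 14) (Pr v (Pr (prog_code p) (prog_code q)))) K) a) u"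
    by (intro interpret_instruction) (simp_all add: exec_Cond_true)
  then show ?case
    unfolding prog_code.simps by (intro interpret_instruction) (simp_all add: exec_Cond_true)
next
  case (exec_Cond_false c v q b p)
  have "exec interpreter_loop
      (Pr (Pr (Pr (Num 14) (Pr v (Pr (prog_code p) (prog_code q)))) K) (Num 0)) u"
    by (intro interpret_instruction) (simp_all add: exec_Cond_false)
  then show ?case
    unfolding prog_code.simps by (intro interpret_instruction) (simp_all add: exec_Cond_false)
next
  case (exec_While_stop c v p)
  \<comment> \<open>Traced backwards: leave through \<open>Skip\<close>, choose that branch on
    \<open>Num 0\<close>, run the test, unfold the loop.\<close>
  let ?r = "prog_code (Seq p (While c p))"
  have "exec interpreter_loop (Pr (Pr (prog_code Skip) K) v) u"
    unfolding prog_code.simps by (intro interpret_instruction) (simp_all add: exec_While_stop)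
  then have "exec interpreter_loop
      (Pr (Pr (Pr (Num 14) (Pr v (Pr ?r (prog_code Skip)))) K) (Num 0)) u"
    by (intro interpret_instruction) simp_all
  then have "exec interpreter_loop
      (Pr (Pr (prog_code (Cond c (Seq p (While c p)) Skip)) K) v) u"
    unfolding prog_code.simps by (intro interpret_instruction) (simp_all add: exec_While_stop)
  then show ?case
    unfolding prog_code.simps by (intro interpret_instruction) simp_all
next
  case (exec_While_step c v a p x w)
  let ?r = "prog_code (Seq p (While c p))"
  have "exec interpreter_loop (Pr (Pr ?r K) v) u"
    using exec_While_step unfolding prog_code.simps
    by (intro interpret_instruction) simp_all
  then have "exec interpreter_loop
      (Pr (Pr (Pr (Num 14) (Pr v (Pr ?r (prog_code Skip)))) K) a) u"
    using exec_While_step.hyps by (intro interpret_instruction) simp_all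
  then have "exec interpreter_loop
      (Pr (Pr (prog_code (Cond c (Seq p (While c p)) Skip)) K) v) u"
    unfolding prog_code.simps by (intro interpret_instruction) (simp_all add: exec_While_step.IH)
  then show ?case
    unfolding prog_code.simps by (intro interpret_instruction) simp_all
qed (unfold prog_code.simps, (rule interpret_instruction; simp)+)

lemma exec_interpreter:
  assumes "exec p v w"
  shows "exec interpreter (Pr (prog_code p) v) w"
proof -
  have "exec interpreter_loop (Pr (Num 0) w) (Pr (Num 0) w)"
    unfolding interpreter_loop_def
    by (rule exec_While_stop, rule exec_loop_free) auto
  from interpreter_loop_exec[OF assms this]
  have "exec interpreter_loop (Pr (Pr (prog_code p) (Num 0)) v) (Pr (Num 0) w)" .
  then show ?thesis
    unfolding interpreter_def
    by (intro exec_Seq[OF exec_loop_free] exec_Seq[OF _ exec_loop_free]) auto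
qed

definition eval_prog :: "prog \<Rightarrow> prog \<Rightarrow> prog" where
  "eval_prog p x = Seq (Tuple p x) interpreter"

lemma exec_eval_prog:
  "exec p e (prog_code q) \<Longrightarrow> exec x e v \<Longrightarrow> exec q v w \<Longrightarrow> exec (eval_prog p x) e w"
  unfolding eval_prog_def by (meson exec_Seq exec_Tuple exec_interpreter)

section \<open>Iteration over lists\<close>

text \<open>
  Programs are now read as expressions in de Bruijn style: the input is a stack of the values of
  variables, and the body of an iteration sees its bound variables pushed onto it.
\<close>

primrec var :: "nat \<Rightarrow> prog" where
  "var 0 = Fst"
| "var (Suc i) = Seq Snd (var i)"

lemma loop_free_var [simp]: "loop_free (var i)"
  by (induction i) auto

text \<open>The loop state is the remaining list, the accumulator and the environment. The body sees
  the current element as variable 0, the accumulator as variable 1 and the outer variables shifted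
  by two.\<close>

definition fold_prog :: "prog \<Rightarrow> prog \<Rightarrow> prog \<Rightarrow> prog" where
  "fold_prog xs init body =
    Seq (Tuple xs (Tuple init Skip))
      (Seq
        (While (Seq Fst is_pair)
          (Tuple (Seq Fst Snd)
            (Tuple (Seq (Tuple (Seq Fst Fst) Snd) body) (Seq Snd Snd))))
        (Seq Snd Fst))"

text \<open>That \<open>body\<close> is only required to run on members of \<open>l\<close> matters
  later: interpreted codes come from such members, and only these are known to halt.\<close>

lemma exec_fold_prog:
  assumes "exec xs e (list_code f l)" "exec init e (g a)"
    and body: "\<And>x a. x \<in> set l \<Longrightarrow> exec body (Pr (f x) (Pr (g a) e)) (g (h x a))"
  shows "exec (fold_prog xs init body) e (g (fold h l a))"
proof -
  let ?b = "Tuple (Seq Fst Snd) (Tuple (Seq (Tuple (Seq Fst Fst) Snd) body) (Seq Snd Snd))"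
  have loop: "exec (While (Seq Fst is_pair) ?b) (Pr (list_code f l) (Pr (g a) e))
      (Pr (Num 0) (Pr (g (fold h l a)) e))"
    using body
  proof (induction l arbitrary: a)
    case Nil
    then show ?case
      by (auto intro!: exec_While_stop exec_loop_free)
  next
    case (Cons x l)
    show ?case
    proof (rule exec_While_step)
      show "exec (Seq Fst is_pair) (Pr (list_code f (x # l)) (Pr (g a) e)) (Num 1)"
        by (rule exec_loop_free) auto
      show "exec ?b (Pr (list_code f (x # l)) (Pr (g a) e))
          (Pr (list_code f l) (Pr (g (h x a)) e))"
      proof (intro exec_Tuple)
        have "exec (Tuple (Seq Fst Fst) Snd) (Pr (list_code f (x # l)) (Pr (g a) e))
            (Pr (f x) (Pr (g a) e))"
          by (rule exec_loop_free) auto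
        then show "exec (Seq (Tuple (Seq Fst Fst) Snd) body)
            (Pr (list_code f (x # l)) (Pr (g a) e)) (g (h x a))"
          using Cons.prems[of x a] by (auto intro: exec_Seq)
      qed (rule exec_loop_free; simp)+
    qed (use Cons in auto)
  qed
  show ?thesis
    unfolding fold_prog_def
    by (rule exec_Seq[OF exec_Tuple[OF assms(1) exec_Tuple[OF assms(2) exec_Skip]]
          exec_Seq[OF loop exec_loop_free]]) auto
qed

definition not_prog :: "prog \<Rightarrow> prog" where
  "not_prog p = Seq (Tuple p (Quote (Num 0))) Equal"

lemma exec_not_prog: "exec p e (truth b) \<Longrightarrow> exec (not_prog p) e (truth (\<not> b))"
  unfolding not_prog_def
  by (rule exec_Seq[OF exec_Tuple[OF _ exec_Quote] exec_loop_free]) auto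

definition and_prog :: "prog \<Rightarrow> prog \<Rightarrow> prog" where
  "and_prog p q = Cond p q (Quote (Num 0))"

lemma exec_and_prog:
  "exec p e (truth a) \<Longrightarrow> exec q e (truth b) \<Longrightarrow> exec (and_prog p q) e (truth (a \<and> b))"
  unfolding and_prog_def by (cases a) (auto intro: exec.intros)

definition or_prog :: "prog \<Rightarrow> prog \<Rightarrow> prog" where
  "or_prog p q = Cond p (Quote (Num 1)) q"

lemma exec_or_prog:
  "exec p e (truth a) \<Longrightarrow> exec q e (truth b) \<Longrightarrow> exec (or_prog p q) e (truth (a \<or> b))"
  unfolding or_prog_def by (cases a) (auto intro: exec.intros)

text \<open>The accumulator is dropped before \<open>body\<close> runs, so this iteration shifts the
  outer variables by one, not two.\<close>

definition any_prog :: "prog \<Rightarrow> prog \<Rightarrow> prog" where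
  "any_prog xs body =
    fold_prog xs (Quote (Num 0)) (or_prog (var 1) (Seq (Tuple Fst (Seq Snd Snd)) body))"

lemma exec_any_prog:
  assumes "exec xs e (list_code f l)"
    and body: "\<And>x. x \<in> set l \<Longrightarrow> exec body (Pr (f x) e) (truth (Q x))"
  shows "exec (any_prog xs body) e (truth (\<exists>x \<in> set l. Q x))"
proof -
  have "exec (any_prog xs body) e (truth (fold (\<lambda>x b. b \<or> Q x) l False))"
    unfolding any_prog_def
  proof (rule exec_fold_prog[OF assms(1)])
    fix x b assume x: "x \<in> set l"
    have "exec (Tuple Fst (Seq Snd Snd)) (Pr (f x) (Pr (truth b) e)) (Pr (f x) e)"
      by (rule exec_loop_free) auto
    then show "exec (or_prog (var 1) (Seq (Tuple Fst (Seq Snd Snd)) body))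
        (Pr (f x) (Pr (truth b) e)) (truth (b \<or> Q x))"
      by (intro exec_or_prog exec_Seq[OF _ body[OF x]]) (auto intro: exec_loop_free)
  qed (auto intro: exec_loop_free)
  moreover have "fold (\<lambda>x b. b \<or> Q x) l c = (c \<or> (\<exists>x \<in> set l. Q x))" for c
    by (induction l arbitrary: c) auto
  ultimately show ?thesis by simp
qed

definition all_prog :: "prog \<Rightarrow> prog \<Rightarrow> prog" where
  "all_prog xs body = not_prog (any_prog xs (not_prog body))"

lemma exec_all_prog:
  assumes "exec xs e (list_code f l)"
    and "\<And>x. x \<in> set l \<Longrightarrow> exec body (Pr (f x) e) (truth (Q x))"
  shows "exec (all_prog xs body) e (truth (\<forall>x \<in> set l. Q x))"
  using exec_not_prog[OF exec_any_prog[OF assms(1) exec_not_prog[OF assms(2)]]]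
  unfolding all_prog_def by simp

text \<open>The counter runs down and is decremented before it is prepended, so the list comes out
  increasing and stops below \<open>n\<close>.\<close>

definition upt_prog :: "prog \<Rightarrow> prog" where
  "upt_prog p =
    Seq (Tuple p (Quote (Num 0)))
      (Seq
        (While Fst
          (Seq (Tuple (Seq (Tuple Fst (Quote (Num 1))) Sub) Snd) (Tuple Fst Skip)))
        Snd)"

lemma exec_upt_prog:
  assumes "exec p e (Num n)"
  shows "exec (upt_prog p) e (list_code Num [0..<n])"
proof -
  let ?b = "Seq (Tuple (Seq (Tuple Fst (Quote (Num 1))) Sub) Snd) (Tuple Fst Skip)"
  have "exec (While Fst ?b) (Pr (Num i) (list_code Num [i..<n])) (Pr (Num 0) (list_code Num [0..<n]))"
    if "i \<le> n" for i
    using that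
  proof (induction i)
    case 0
    show ?case by (intro exec_While_stop exec_loop_free) auto
  next
    case (Suc i)
    show ?case
    proof (rule exec_While_step)
      show "exec Fst (Pr (Num (Suc i)) (list_code Num [Suc i..<n])) (Num (Suc i))"
        by (rule exec_loop_free) auto
      show "exec ?b (Pr (Num (Suc i)) (list_code Num [Suc i..<n]))
          (Pr (Num i) (list_code Num [i..<n]))"
        using Suc.prems by (intro exec_loop_free) (auto simp: upt_conv_Cons)
    qed (use Suc in auto)
  qed
  from this[of n]
  have "exec (While Fst ?b) (Pr (Num n) (Num 0)) (Pr (Num 0) (list_code Num [0..<n]))"
    by simp
  then show ?thesis
    unfolding upt_prog_def
    by (intro exec_Seq[OF exec_Tuple[OF assms exec_Quote]] exec_Seq[OF _ exec_loop_free]) auto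
qed

section \<open>Checking proof steps\<close>

lemma inj_list_code: "inj f \<Longrightarrow> inj (list_code f)"
proof (rule injI)
  fix xs ys assume "inj f" "list_code f xs = list_code f ys"
  then show "xs = ys"
  proof (induction xs arbitrary: ys)
    case Nil
    then show ?case by (cases ys) auto
  next
    case (Cons x xs)
    then show ?case by (cases ys) (auto dest: injD)
  qed
qed

lemma inj_expr_code: "inj expr_code"
  unfolding expr_code_def by (intro inj_list_code injI) simp

text \<open>Enumerates the candidate lists of premises of a rule. The nested folds are there for
  \<open>tuples_prog\<close> to imitate one by one.\<close>

definition tuples :: "'a list \<Rightarrow> nat \<Rightarrow> 'a list list" where
  "tuples xs k =
    fold (\<lambda>_ yss. fold (\<lambda>ys zss. fold (\<lambda>x. (#) (x # ys)) xs zss) yss []) [0..<k] [[]]"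

lemma set_fold_Cons: "set (fold (\<lambda>x. (#) (f x)) xs ys) = f ` set xs \<union> set ys"
  by (induction xs arbitrary: ys) auto

lemma set_fold_fold_Cons:
  "set (fold (\<lambda>ys zss. fold (\<lambda>x. (#) (x # ys)) xs zss) yss zss) =
    {x # ys | x ys. x \<in> set xs \<and> ys \<in> set yss} \<union> set zss"
  by (induction yss arbitrary: zss) (auto simp: set_fold_Cons)

lemma set_tuples: "set (tuples xs k) = {ys. length ys = k \<and> set ys \<subseteq> set xs}"
proof (induction k)
  case 0
  show ?case by (auto simp: tuples_def)
next
  case (Suc k)
  have "set (tuples xs (Suc k)) = {x # ys | x ys. x \<in> set xs \<and> ys \<in> set (tuples xs k)}"
    by (simp add: tuples_def set_fold_fold_Cons)
  also have "\<dots> = {ys. length ys = Suc k \<and> set ys \<subseteq> set xs}"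
    unfolding Suc.IH by (auto simp: length_Suc_conv)
  finally show ?case .
qed

text \<open>The quoted pair codes \<open>[[]]\<close>. Two enclosing iterations bind four variables,
  so \<open>var 4\<close> is the list \<open>xs\<close>.\<close>

definition tuples_prog :: "prog \<Rightarrow> prog \<Rightarrow> prog" where
  "tuples_prog xs k =
    Seq (Tuple xs k)
      (fold_prog (upt_prog Snd) (Quote (Pr (Num 0) (Num 0)))
        (fold_prog (var 1) (Quote (Num 0))
          (fold_prog (var 4) (var 1)
            (Tuple (Tuple Fst (var 2)) (var 1)))))"

lemma exec_tuples_prog:
  assumes "exec xs e (list_code f l)" "exec k e (Num n)"
  shows "exec (tuples_prog xs k) e (list_code (list_code f) (tuples l n))"
  unfolding tuples_prog_def
proof (rule exec_Seq[OF exec_Tuple[OF assms]])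
  show "exec (fold_prog (upt_prog Snd) (Quote (Pr (Num 0) (Num 0)))
      (fold_prog (var 1) (Quote (Num 0))
        (fold_prog (var 4) (var 1) (Tuple (Tuple Fst (var 2)) (var 1)))))
      (Pr (list_code f l) (Num n)) (list_code (list_code f) (tuples l n))"
    unfolding tuples_def
    by (intro exec_fold_prog[where f = Num] exec_fold_prog[where f = "list_code f"]
        exec_fold_prog[where f = f] exec_upt_prog)
      (auto intro!: exec_loop_free simp: eval_nat_numeral)
qed

text \<open>
  The input of \<open>step_prog\<close> consists of a step, the earlier steps and the description of the
  language and the axiomatization.
\<close>

abbreviation (input) "alphabet_prog \<equiv> Seq Fst Fst"
abbreviation (input) "prop_test_prog \<equiv> Seq Fst (Seq Snd Fst)"
abbreviation (input) "schemas_prog \<equiv> Seq Snd (Seq Fst Fst)"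
abbreviation (input) "rules_prog \<equiv> Seq Snd (Seq Fst Snd)"
abbreviation (input) "reader_prog \<equiv> Seq Snd Snd"

definition step_prog :: prog where
  "step_prog =
    and_prog
      (all_prog (Seq Fst Fst) (eval_prog (Seq Snd (Seq Snd (Seq Snd prop_test_prog))) Fst))
      (and_prog
        (eval_prog (Seq Snd (Seq Snd prop_test_prog)) (Seq Fst Snd))
        (or_prog
          (any_prog (Seq Fst Fst) (Seq (Tuple (Seq (var 1) Snd) Fst) Equal))
          (or_prog
            (any_prog (Seq Snd (Seq Snd schemas_prog)) (eval_prog Fst (Seq (var 1) Snd)))
            (any_prog (Seq Snd (Seq Snd rules_prog))
              (any_prog (tuples_prog (var 2) (Seq Fst Fst))
                (eval_prog (Seq (var 1) Snd) (Tuple Fst (var 2))))))))"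

text \<open>All interpreted tests are deciders, by \<open>formal_language\<close> and
  \<open>axiom_system\<close>, so the check halts on incorrect steps too.\<close>

lemma exec_step_prog:
  assumes L: "formal_language L" and A: "axiom_system A"
  shows "exec step_prog (Pr (step_code s) (Pr (list_code step_code t) (description L A rd)))
    (truth (correct_step L A t s))"
proof -
  let ?D = "description L A rd"
  let ?e = "Pr (step_code s) (Pr (list_code step_code t) ?D)"
  have test: "exec (prop_test L) (expr_code x) (truth (x \<in> propositions L))" for x
    using exec_accepts[of "prop_test L"] L by (simp add: formal_language_def propositions_def)
  have 1: "exec (all_prog (Seq Fst Fst) (eval_prog (Seq Snd (Seq Snd (Seq Snd prop_test_prog))) Fst))
      ?e (truth (\<forall>x \<in> set (fst s). x \<in> propositions L))"
    by (intro exec_all_prog[where f = expr_code] exec_eval_prog[OF _ _ test])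
      (auto intro!: exec_loop_free simp: step_code_def description_def)
  have 2: "exec (eval_prog (Seq Snd (Seq Snd prop_test_prog)) (Seq Fst Snd))
      ?e (truth (snd s \<in> propositions L))"
    by (intro exec_eval_prog[OF _ _ test])
      (auto intro!: exec_loop_free simp: step_code_def description_def)
  \<comment> \<open>\<open>Equal\<close> compares codes; injectivity of \<open>expr_code\<close>
    turns this into equality of expressions.\<close>
  have 3: "exec (any_prog (Seq Fst Fst) (Seq (Tuple (Seq (var 1) Snd) Fst) Equal))
      ?e (truth (\<exists>x \<in> set (fst s). snd s = x))"
    by (intro exec_any_prog[where f = expr_code])
      (auto intro!: exec_loop_free simp: step_code_def inj_eq[OF inj_expr_code])
  have 4: "exec (any_prog (Seq Snd (Seq Snd schemas_prog)) (eval_prog Fst (Seq (var 1) Snd)))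
      ?e (truth (\<exists>p \<in> set (schemas A). accepts p (expr_code (snd s))))"
    using A
    by (intro exec_any_prog[where f = prog_code] exec_eval_prog[OF _ _ exec_accepts])
      (auto intro!: exec_loop_free simp: step_code_def description_def axiom_system_def)
  let ?f = "\<lambda>(k, p). Pr (Num k) (prog_code p)"
  \<comment> \<open>The arity stored with the rule bounds the search: only finitely many lists of
    earlier steps have that length.\<close>
  have 5: "exec (any_prog (tuples_prog (var 2) (Seq Fst Fst))
        (eval_prog (Seq (var 1) Snd) (Tuple Fst (var 2))))
      (Pr (?f r) ?e)
      (truth (\<exists>prems \<in> set (tuples t (fst r)).
        accepts (snd r) (Pr (list_code step_code prems) (step_code s))))"
    if "r \<in> set (rules A)" for r
    using A that
    by (intro exec_any_prog[where f = "list_code step_code"] exec_tuples_prog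
        exec_eval_prog[OF _ _ exec_accepts])
      (auto intro!: exec_loop_free simp: axiom_system_def eval_nat_numeral prod.case_eq_if)
  have 6: "exec (any_prog (Seq Snd (Seq Snd rules_prog))
        (any_prog (tuples_prog (var 2) (Seq Fst Fst))
          (eval_prog (Seq (var 1) Snd) (Tuple Fst (var 2)))))
      ?e (truth (\<exists>r \<in> set (rules A). \<exists>prems \<in> set (tuples t (fst r)).
        accepts (snd r) (Pr (list_code step_code prems) (step_code s))))"
    by (rule exec_any_prog[where f = ?f, OF _ 5])
      (auto intro!: exec_loop_free simp: description_def)
  have "correct_step L A t s \<longleftrightarrow>
      (\<forall>x \<in> set (fst s). x \<in> propositions L) \<and> snd s \<in> propositions L \<and>
      ((\<exists>x \<in> set (fst s). snd s = x) \<or>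
       (\<exists>p \<in> set (schemas A). accepts p (expr_code (snd s))) \<or>
       (\<exists>r \<in> set (rules A). \<exists>prems \<in> set (tuples t (fst r)).
        accepts (snd r) (Pr (list_code step_code prems) (step_code s))))"
    unfolding correct_step_def set_tuples case_prod_beta by (simp add: subset_eq Bex_def conj_assoc)
  with exec_and_prog[OF 1 exec_and_prog[OF 2 exec_or_prog[OF 3 exec_or_prog[OF 4 6]]]]
  show ?thesis
    unfolding step_prog_def by simp
qed

section \<open>Enumerating proofs\<close>

text \<open>
  A partial proof \<open>(g, h, t)\<close> consists of an expression \<open>g\<close> being written, finished hypotheses
  \<open>h\<close> of the current step and the finished steps \<open>t\<close>, the latest first. It is extended by one
  symbol, which is a letter, a separator (making \<open>g\<close> a hypothesis) or a turnstile (making \<open>g\<close> the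
  conclusion). So every symbol accounts for one unit of the length of the proof.
\<close>

type_synonym partial_proof = "expr \<times> expr list \<times> step list"

fun extend ::
  "(step list \<Rightarrow> step \<Rightarrow> bool) \<Rightarrow> nat \<Rightarrow> partial_proof \<Rightarrow> partial_proof list \<Rightarrow> partial_proof list"
where
  "extend ok a (g, h, t) acc =
    fold (\<lambda>x. (#) (x # g, h, t)) [0..<a]
      ((g, h, t) # ([], g # h, t) # (if ok t (h, g) then ([], [], (h, g) # t) # acc else acc))"

text \<open>As \<open>extend\<close> also keeps the old partial proof, \<open>n\<close> rounds give
  all lengths up to \<open>n\<close>, not just \<open>n\<close> itself.\<close>

definition partial_proofs ::
  "(step list \<Rightarrow> step \<Rightarrow> bool) \<Rightarrow> nat \<Rightarrow> nat \<Rightarrow> partial_proof list" where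
  "partial_proofs ok a n = fold (\<lambda>_ X. fold (extend ok a) X []) [0..<n] [([], [], [])]"

primrec correct_steps :: "(step list \<Rightarrow> step \<Rightarrow> bool) \<Rightarrow> step list \<Rightarrow> bool" where
  "correct_steps ok [] \<longleftrightarrow> True"
| "correct_steps ok (s # t) \<longleftrightarrow> ok t s \<and> correct_steps ok t"

fun partial_length :: "partial_proof \<Rightarrow> nat" where
  "partial_length (g, h, t) = length g + (\<Sum>\<gamma>\<leftarrow>h. length \<gamma> + 1) + proof_length t"

lemma set_fold_extend:
  "set (fold (extend ok a) X acc) = (\<Union>x \<in> set X. set (extend ok a x [])) \<union> set acc"
proof (induction X arbitrary: acc)
  case (Cons x X)
  have "set (extend ok a x acc) = set (extend ok a x []) \<union> set acc"
    by (cases x) (auto simp: set_fold_Cons)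
  with Cons show ?case by auto
qed simp

lemma set_partial_proofs_Suc:
  "set (partial_proofs ok a (Suc n)) = (\<Union>x \<in> set (partial_proofs ok a n). set (extend ok a x []))"
  by (simp add: partial_proofs_def set_fold_extend)

text \<open>A round adds at most one to \<open>partial_length\<close>, and a step is finished only
  after passing \<open>ok\<close>.\<close>

lemma partial_proofs_sound:
  "(g, h, t) \<in> set (partial_proofs ok a n) \<Longrightarrow>
    correct_steps ok t \<and> partial_length (g, h, t) \<le> n"
proof (induction n arbitrary: g h t)
  case 0
  then show ?case by (simp add: partial_proofs_def proof_length_def)
next
  case (Suc n)
  then obtain g' h' t' where "(g', h', t') \<in> set (partial_proofs ok a n)"
    and "(g, h, t) \<in> set (extend ok a (g', h', t') [])"
    by (auto simp: set_partial_proofs_Suc simp del: extend.simps)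
  with Suc.IH[of g' h' t'] show ?case
    by (auto simp: set_fold_Cons proof_length_def step_length_def split: if_splits)
qed

text \<open>Induction on \<open>n\<close>, undoing the latest symbol: drop the head letter of
  \<open>g\<close>; if there is none, reopen the latest hypothesis; if there is none, reopen the
  latest step before its turnstile. The empty partial proof is kept by
  \<open>extend\<close>.\<close>

lemma partial_proofs_complete:
  assumes "correct_steps ok t" "partial_length (g, h, t) \<le> n"
    and "g \<in> lists {..<a}" "set h \<subseteq> lists {..<a}"
    and "\<And>s. s \<in> set t \<Longrightarrow> snd s \<in> lists {..<a} \<and> set (fst s) \<subseteq> lists {..<a}"
  shows "(g, h, t) \<in> set (partial_proofs ok a n)"
  using assms
proof (induction n arbitrary: g h t)
  case 0
  then show ?case
    by (cases h; cases t) (auto simp: partial_proofs_def proof_length_def step_length_def)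
next
  case (Suc n)
  have extend: ?case if "(g, h, t) \<in> set (extend ok a (g', h', t') [])"
    and "(g', h', t') \<in> set (partial_proofs ok a n)" for g' h' t'
    using that unfolding set_partial_proofs_Suc by blast
  show ?case
  proof (cases g)
    case (Cons x g')
    show ?thesis
      by (rule extend[of g' h t], use Suc.prems Cons in \<open>force simp: set_fold_Cons\<close>,
          rule Suc.IH) (use Suc.prems Cons in auto)
  next
    case g: Nil
    show ?thesis
    proof (cases h)
      case (Cons \<gamma> h')
      show ?thesis
        by (rule extend[of \<gamma> h' t], use Suc.prems g Cons in \<open>force simp: set_fold_Cons\<close>,
            rule Suc.IH) (use Suc.prems g Cons in auto)
    next
      case h: Nil
      show ?thesis
      proof (cases t)
        case Nil
        show ?thesis
          by (rule extend[of g h t], use g h Nil in \<open>force simp: set_fold_Cons\<close>,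
              rule Suc.IH) (use g h Nil in \<open>auto simp: proof_length_def\<close>)
      next
        case (Cons s t')
        show ?thesis
          by (rule extend[of "snd s" "fst s" t'],
              use Suc.prems g h Cons in \<open>force simp: set_fold_Cons\<close>,
              rule Suc.IH)
            (use Suc.prems g h Cons in \<open>auto simp: proof_length_def step_length_def\<close>)
      qed
    qed
  qed
qed

text \<open>Only the set of earlier steps enters \<open>correct_step\<close>, which is why the
  enumeration may store the latest step first.\<close>

lemma correct_step_rev: "correct_step L A (rev t) s \<longleftrightarrow> correct_step L A t s"
  by (simp add: correct_step_def)

lemma correct_steps_rev:
  "(\<forall>i < length ss. correct_step L A (take i ss) (ss ! i)) \<longleftrightarrow> correct_steps (correct_step L A) (rev ss)"
proof (induction ss rule: rev_induct)
  case (snoc s ss)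
  have "(\<forall>i < length (ss @ [s]). correct_step L A (take i (ss @ [s])) ((ss @ [s]) ! i)) \<longleftrightarrow>
      (\<forall>i < length ss. correct_step L A (take i ss) (ss ! i)) \<and> correct_step L A ss s"
    by (auto simp: nth_append less_Suc_eq)
  with snoc correct_step_rev[of L A ss s] show ?case by auto
qed simp

lemma is_proof_of_rev:
  "is_proof_of L A (rev t) \<phi> \<longleftrightarrow> correct_steps (correct_step L A) t \<and> (\<exists>t'. t = ([], \<phi>) # t')"
  unfolding is_proof_of_def correct_steps_rev by (cases t) auto

lemma proof_length_rev: "proof_length (rev t) = proof_length t"
  by (simp add: proof_length_def flip: rev_map)

lemma correct_steps_in_propositions:
  "correct_steps (correct_step L A) t \<Longrightarrow> s \<in> set t \<Longrightarrow>
    snd s \<in> propositions L \<and> set (fst s) \<subseteq> propositions L"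
  by (induction t) (auto simp: correct_step_def)

text \<open>Completeness applies with nothing unfinished, because correct steps consist of
  propositions, hence of strings over the alphabet.\<close>

lemma partial_proofs_iff:
  assumes "formal_language L"
  shows "(\<exists>g h. (g, h, t) \<in> set (partial_proofs (correct_step L A) (alphabet L) n)) \<longleftrightarrow>
    correct_steps (correct_step L A) t \<and> proof_length t \<le> n"
proof
  assume "correct_steps (correct_step L A) t \<and> proof_length t \<le> n"
  moreover have "propositions L \<subseteq> lists {..<alphabet L}"
    using assms by (simp add: formal_language_def)
  ultimately have "([], [], t) \<in> set (partial_proofs (correct_step L A) (alphabet L) n)"
    using correct_steps_in_propositions[of L A t]
    by (intro partial_proofs_complete) (simp, simp, simp, simp, blast)
  then show "\<exists>g h. (g, h, t) \<in> set (partial_proofs (correct_step L A) (alphabet L) n)"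
    by blast
next
  assume "\<exists>g h. (g, h, t) \<in> set (partial_proofs (correct_step L A) (alphabet L) n)"
  then show "correct_steps (correct_step L A) t \<and> proof_length t \<le> n"
    using partial_proofs_sound by fastforce
qed

fun partial_code :: "partial_proof \<Rightarrow> data" where
  "partial_code (g, h, t) = Pr (expr_code g) (Pr (list_code expr_code h) (list_code step_code t))"

text \<open>Variable 0 is the partial proof and variable 1 the accumulator; past the two variables
  of the outer iteration, \<open>var 4\<close> is the description.\<close>

definition finish_step_prog :: prog where
  "finish_step_prog =
    Cond
      (Seq
        (Tuple (Tuple (Seq Fst (var 1)) (Seq Fst Fst)) (Tuple (Seq Fst (Seq Snd Snd)) (var 4)))
        step_prog)
      (Tuple
        (Tuple (Quote (Num 0))
          (Tuple (Quote (Num 0))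
            (Tuple (Tuple (Seq Fst (var 1)) (Seq Fst Fst)) (Seq Fst (Seq Snd Snd)))))
        (var 1))
      (var 1)"

definition extend_prog :: prog where
  "extend_prog =
    fold_prog (upt_prog (Seq (var 4) alphabet_prog))
      (Tuple Fst
        (Tuple
          (Tuple (Quote (Num 0)) (Tuple (Tuple (Seq Fst Fst) (Seq Fst (var 1))) (Seq Fst (Seq Snd Snd))))
          finish_step_prog))
      (Tuple (Tuple (Tuple Fst (Seq (var 2) Fst)) (Seq (var 2) Snd)) (var 1))"

definition partial_proofs_prog :: prog where
  "partial_proofs_prog =
    fold_prog (upt_prog Snd) (Quote (list_code partial_code [([], [], [])]))
      (fold_prog (var 1) (Quote (Num 0)) extend_prog)"

lemma exec_extend_prog:
  assumes L: "formal_language L" and A: "axiom_system A"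
  shows "exec extend_prog
    (Pr (partial_code x)
      (Pr (list_code partial_code acc) (Pr i (Pr X (Pr (description L A rd) m)))))
    (list_code partial_code (extend (correct_step L A) (alphabet L) x acc))"
proof -
  obtain g h t where x: "x = (g, h, t)" by (cases x)
  let ?e = "Pr (partial_code x)
      (Pr (list_code partial_code acc) (Pr i (Pr X (Pr (description L A rd) m))))"
  have "exec (Tuple (Tuple (Seq Fst (var 1)) (Seq Fst Fst)) (Tuple (Seq Fst (Seq Snd Snd)) (var 4))) ?e
      (Pr (step_code (h, g)) (Pr (list_code step_code t) (description L A rd)))"
    by (rule exec_loop_free) (auto simp: x step_code_def eval_nat_numeral)
  from exec_Seq[OF this exec_step_prog[OF L A]]
  have check: "exec (Seq
      (Tuple (Tuple (Seq Fst (var 1)) (Seq Fst Fst)) (Tuple (Seq Fst (Seq Snd Snd)) (var 4)))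
      step_prog) ?e (truth (correct_step L A t (h, g)))" .
  have finish: "exec finish_step_prog ?e
      (list_code partial_code
        (if correct_step L A t (h, g) then ([], [], (h, g) # t) # acc else acc))"
  proof (cases "correct_step L A t (h, g)")
    case True
    show ?thesis
      unfolding finish_step_prog_def
      by (rule exec_Cond_true[OF check], simp add: True, rule exec_loop_free)
        (auto simp: True x step_code_def expr_code_def)
  next
    case False
    with check show ?thesis
      unfolding finish_step_prog_def
      by (intro exec_Cond_false[OF _ exec_loop_free]) auto
  qed
  have "exec extend_prog ?e
      (list_code partial_code
        (fold (\<lambda>a. (#) (a # g, h, t)) [0..<alphabet L]
          ((g, h, t) # ([], g # h, t) #
            (if correct_step L A t (h, g) then ([], [], (h, g) # t) # acc else acc))))"
    unfolding extend_prog_def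
  proof (rule exec_fold_prog[where f = Num])
    show "exec (upt_prog (Seq (var 4) alphabet_prog)) ?e (list_code Num [0..<alphabet L])"
      by (rule exec_upt_prog, rule exec_loop_free) (auto simp: description_def eval_nat_numeral)
    show "exec (Tuple Fst
        (Tuple
          (Tuple (Quote (Num 0)) (Tuple (Tuple (Seq Fst Fst) (Seq Fst (var 1))) (Seq Fst (Seq Snd Snd))))
          finish_step_prog)) ?e
        (list_code partial_code ((g, h, t) # ([], g # h, t) #
          (if correct_step L A t (h, g) then ([], [], (h, g) # t) # acc else acc)))"
      unfolding list_code.simps
      by (rule exec_Tuple[OF _ exec_Tuple[OF _ finish]]; rule exec_loop_free)
        (auto simp: x expr_code_def)
  qed (auto intro!: exec_loop_free simp: x expr_code_def eval_nat_numeral)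
  then show ?thesis
    by (simp add: x)
qed

lemma exec_partial_proofs_prog:
  assumes "formal_language L" "axiom_system A"
  shows "exec partial_proofs_prog (Pr (description L A rd) (Num n))
    (list_code partial_code (partial_proofs (correct_step L A) (alphabet L) n))"
  unfolding partial_proofs_prog_def partial_proofs_def
  by (intro exec_fold_prog[where f = Num] exec_fold_prog[where f = partial_code]
      exec_extend_prog[OF assms] exec_upt_prog)
    (auto intro!: exec_loop_free)

section \<open>The largest output\<close>

lemma inj_prog_code: "inj prog_code"
proof -
  have "\<forall>q. prog_code p = prog_code q \<longrightarrow> p = q" for p
    by (induction p; rule allI; case_tac q; simp)
  then show ?thesis by (auto intro: injI)
qed

lemma prog_code_Pr: "\<exists>a b. prog_code p = Pr a b"
  by (cases p) auto

text \<open>The tests in turn: is any step finished, has the latest one no hypotheses, does the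
  reader return a program, is its output a number. Otherwise the old maximum \<open>k\<close> is
  kept. Truncated subtraction yields the new one, as \<open>j - k + k\<close> is the maximum of
  \<open>j\<close> and \<open>k\<close>.\<close>

definition max_prog :: prog where
  "max_prog =
    Cond (Seq Fst (Seq Snd (Seq Snd is_pair)))
      (Cond (Seq Fst (Seq Snd (Seq Snd (Seq Fst (Seq Fst is_pair)))))
        (var 1)
        (Seq
          (Tuple (eval_prog (Seq (var 2) reader_prog) (Seq Fst (Seq Snd (Seq Snd (Seq Fst Snd))))) Skip)
          (Cond (Seq Fst is_pair)
            (Seq
              (Tuple (eval_prog Fst (Quote (Num 0))) Skip)
              (Cond (Seq Fst is_pair)
                (var 3)
                (Seq (Tuple (Seq (Tuple Fst (var 3)) Sub) (var 3)) Add)))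
            (var 2))))
      (var 1)"

definition universal_prog :: prog where
  "universal_prog = fold_prog partial_proofs_prog (Quote (Num 0)) max_prog"

definition proved_outputs :: "(prog \<Rightarrow> expr) \<Rightarrow> step list \<Rightarrow> nat set" where
  "proved_outputs hs t = {m. \<exists>\<alpha> t'. t = ([], hs \<alpha>) # t' \<and> outputs \<alpha> m}"

text \<open>The last step of a proof is the head of the reversed list, so a partial proof
  contributes through the head of \<open>t\<close>, whatever is being written after it.\<close>

lemma provable_outputs_eq:
  assumes "formal_language L"
  shows "provable_outputs L A hs n =
    (\<Union>(g, h, t) \<in> set (partial_proofs (correct_step L A) (alphabet L) n). proved_outputs hs t)"
proof -
  have "m \<in> provable_outputs L A hs n \<longleftrightarrow>
      (\<exists>t. (\<exists>g h. (g, h, t) \<in> set (partial_proofs (correct_step L A) (alphabet L) n)) \<and>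
        m \<in> proved_outputs hs t)" for m
  proof -
    have "m \<in> provable_outputs L A hs n \<longleftrightarrow>
        (\<exists>t \<alpha>. is_proof_of L A (rev t) (hs \<alpha>) \<and> proof_length (rev t) \<le> n \<and> outputs \<alpha> m)"
      unfolding provable_outputs_def mem_Collect_eq by (metis rev_rev_ident)
    then show ?thesis
      unfolding is_proof_of_rev proof_length_rev partial_proofs_iff[OF assms] proved_outputs_def
      by blast
  qed
  then show ?thesis by fast
qed

text \<open>An algorithm is run only if the finished steps, reversed, prove that it halts; the
  hypothesis \<open>halts\<close> then makes the run terminate.\<close>

lemma exec_max_prog:
  assumes reads: "reads_halting L hs rd"
    and halts: "\<And>\<alpha> ss. is_proof_of L A ss (hs \<alpha>) \<Longrightarrow> halts \<alpha>"
    and t: "correct_steps (correct_step L A) t"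
  shows "finite (proved_outputs hs t) \<and>
    exec max_prog (Pr (partial_code (g, h, t)) (Pr (Num k) (Pr (description L A rd) m)))
      (Num (Max (insert k (proved_outputs hs t))))"
proof -
  let ?e = "Pr (partial_code (g, h, t)) (Pr (Num k) (Pr (description L A rd) m))"
  \<comment> \<open>The deterministic reader recovers the code of the algorithm from its halting
    sentence.\<close>
  have inj: "\<alpha> = \<beta>" if "hs \<alpha> = hs \<beta>" for \<alpha> \<beta>
    using reads that exec_deterministic injD[OF inj_prog_code]
    unfolding reads_halting_def by metis
  show ?thesis
  proof (cases "\<exists>\<phi> t'. t = ([], \<phi>) # t'")
    case False
    then have "proved_outputs hs t = {}"
      by (auto simp: proved_outputs_def)
    moreover have "exec max_prog ?e (Num k)"
    proof (cases t)
      case Nil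
      then show ?thesis
        unfolding max_prog_def by (intro exec_Cond_false exec_loop_free) auto
    next
      case (Cons s t')
      with False obtain \<gamma> \<Gamma> where s: "fst s = \<gamma> # \<Gamma>"
        by (cases s; cases "fst s") auto
      show ?thesis
        unfolding max_prog_def
        by (rule exec_Cond_true[where a = "Num 1"], rule exec_loop_free,
            simp, simp add: Cons, simp,
            rule exec_Cond_true[where a = "Num 1"], rule exec_loop_free)
          (auto simp: Cons s step_code_def intro: exec_loop_free)
    qed
    ultimately show ?thesis by simp
  next
    case True
    then obtain \<phi> t' where t_eq: "t = ([], \<phi>) # t'" by blast
    let ?q = "Cond (Seq Fst is_pair)
            (Seq
              (Tuple (eval_prog Fst (Quote (Num 0))) Skip)
              (Cond (Seq Fst is_pair)
                (var 3)
                (Seq (Tuple (Seq (Tuple Fst (var 3)) Sub) (var 3)) Add)))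
            (var 2)"
    have start: "exec max_prog ?e w" if "exec rd (expr_code \<phi>) r" "exec ?q (Pr r ?e) w" for r w
    proof -
      have "exec (eval_prog (Seq (var 2) reader_prog) (Seq Fst (Seq Snd (Seq Snd (Seq Fst Snd))))) ?e r"
        by (rule exec_eval_prog[OF _ _ that(1)])
          (auto intro!: exec_loop_free simp: t_eq step_code_def description_def eval_nat_numeral)
      then have eval: "exec (Seq
          (Tuple (eval_prog (Seq (var 2) reader_prog) (Seq Fst (Seq Snd (Seq Snd (Seq Fst Snd))))) Skip)
          ?q) ?e w"
        by (rule exec_Seq[OF exec_Tuple[OF _ exec_Skip] that(2)])
      have "exec (Seq Fst (Seq Snd (Seq Snd is_pair))) ?e (Num 1)"
        "exec (Seq Fst (Seq Snd (Seq Snd (Seq Fst (Seq Fst is_pair))))) ?e (Num 0)"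
        by (rule exec_loop_free; simp add: t_eq step_code_def)+
      from exec_Cond_true[OF this(1) _ exec_Cond_false[OF this(2) eval]] show ?thesis
        unfolding max_prog_def by simp
    qed
    \<comment> \<open>Outside the range of \<open>hs\<close>, the reader is known to answer only on
      propositions.\<close>
    have \<phi>: "\<phi> \<in> propositions L"
      using correct_steps_in_propositions[OF t, of "([], \<phi>)"] t_eq by simp
    show ?thesis
    proof (cases "\<phi> \<in> range hs")
      case False
      then have "proved_outputs hs t = {}"
        by (auto simp: proved_outputs_def t_eq)
      moreover have "exec rd (expr_code \<phi>) (Num 0)"
        using reads False \<phi> unfolding reads_halting_def by blast
      then have "exec max_prog ?e (Num k)"
        by (rule start, intro exec_Cond_false exec_loop_free) (auto simp: eval_nat_numeral)
      ultimately show ?thesis by simp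
    next
      case True
      then obtain \<alpha> where \<alpha>: "\<phi> = hs \<alpha>" by blast
      \<comment> \<open>This makes it safe to run \<open>\<alpha>\<close>.\<close>
      have "is_proof_of L A (rev t) (hs \<alpha>)"
        using t t_eq \<alpha> unfolding is_proof_of_rev by simp
      then obtain r where r: "exec \<alpha> (Num 0) r"
        using halts halts_def by blast
      have "proved_outputs hs t = {m. \<exists>\<beta>. hs \<alpha> = hs \<beta> \<and> outputs \<beta> m}"
        by (auto simp: proved_outputs_def t_eq \<alpha>)
      also have "\<dots> = {m. r = Num m}"
        unfolding outputs_def using inj r exec_deterministic[OF r] by blast
      finally have outs: "proved_outputs hs t = {m. r = Num m}" .
      have rd: "exec rd (expr_code \<phi>) (prog_code \<alpha>)"
        using reads unfolding reads_halting_def \<alpha> by blast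
      have eval: "exec (eval_prog Fst (Quote (Num 0))) (Pr (prog_code \<alpha>) ?e) r"
        by (rule exec_eval_prog[OF _ _ r]) (auto intro!: exec_loop_free)
      have pair: "exec (Seq Fst is_pair) (Pr (prog_code \<alpha>) ?e) (Num 1)"
        using prog_code_Pr[of \<alpha>] by (auto intro!: exec_loop_free)
      show ?thesis
      proof (cases r)
        case (Num j)
        have "exec max_prog ?e (Num (j - k + k))"
          by (rule start[OF rd], rule exec_Cond_true[OF pair], simp,
              rule exec_Seq[OF exec_Tuple[OF eval exec_Skip]], rule exec_Cond_false)
            (auto intro!: exec_loop_free simp: Num eval_nat_numeral)
        moreover have "j - k + k = max k j" by simp
        ultimately show ?thesis
          using Num outs by simp
      next
        case (Pr a b)
        have "exec max_prog ?e (Num k)"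
          by (rule start[OF rd], rule exec_Cond_true[OF pair], simp,
              rule exec_Seq[OF exec_Tuple[OF eval exec_Skip]],
              rule exec_Cond_true[where a = "Num 1"])
            (auto intro!: exec_loop_free simp: Pr eval_nat_numeral)
        then show ?thesis
          using Pr outs by simp
      qed
    qed
  qed
qed

lemma fold_Max_insert:
  assumes "\<And>x. x \<in> set xs \<Longrightarrow> finite (B x)"
  shows "fold (\<lambda>x k. Max (insert k (B x))) xs k = Max (insert (k :: nat) (\<Union>x \<in> set xs. B x))"
  using assms
proof (induction xs arbitrary: k)
  case (Cons x xs)
  let ?U = "\<Union>y \<in> set xs. B y"
  have fin: "finite (B x)" "finite ?U"
    using Cons.prems by auto
  have "Max (insert (Max (insert k (B x))) ?U) = Max (insert k (B x) \<union> ?U)"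
  proof (cases "?U = {}")
    case False
    then show ?thesis
      using fin Max_Un[of "insert k (B x)" ?U] by (simp del: Un_insert_left Max_insert add: Max_insert[of ?U])
  qed simp
  with Cons show ?case by simp
qed simp

lemma exec_universal_prog:
  assumes L: "formal_language L" and A: "axiom_system A" and reads: "reads_halting L hs rd"
    and halts: "\<And>\<alpha> ss. is_proof_of L A ss (hs \<alpha>) \<Longrightarrow> halts \<alpha>"
  defines "S \<equiv> provable_outputs L A hs"
  shows "finite (S n)"
    and "exec universal_prog (Pr (description L A rd) (Num n)) (Num (Max (insert 0 (S n))))"
proof -
  let ?X = "partial_proofs (correct_step L A) (alphabet L) n"
  let ?B = "\<lambda>(g, h, t). proved_outputs hs t"
  have S: "S n = (\<Union>x \<in> set ?X. ?B x)"
    unfolding S_def by (rule provable_outputs_eq[OF L])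
  have max: "finite (?B x) \<and>
      exec max_prog (Pr (partial_code x) (Pr (Num k) (Pr (description L A rd) m)))
        (Num (Max (insert k (?B x))))" if "x \<in> set ?X" for x k m
  proof -
    obtain g h t where x: "x = (g, h, t)" by (cases x)
    then have "correct_steps (correct_step L A) t"
      using that partial_proofs_sound by blast
    from exec_max_prog[OF reads halts this] show ?thesis
      unfolding x by simp
  qed
  show "finite (S n)"
    unfolding S using max by blast
  have "exec universal_prog (Pr (description L A rd) (Num n))
      (Num (fold (\<lambda>x k. Max (insert k (?B x))) ?X 0))"
    unfolding universal_prog_def
    by (rule exec_fold_prog[OF exec_partial_proofs_prog[OF L A]])
      (use max in \<open>auto intro: exec_Quote\<close>)
  then show "exec universal_prog (Pr (description L A rd) (Num n)) (Num (Max (insert 0 (S n))))"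
    unfolding S using max by (subst (asm) fold_Max_insert) blast+
qed

section \<open>The program and its length\<close>

definition output_prog :: "data \<Rightarrow> nat \<Rightarrow> prog" where
  "output_prog d n = Seq (Quote (Pr d (Num n))) universal_prog"

text \<open>The tags 9 and 1 are those of \<open>Seq\<close> and \<open>Quote\<close>; the input
  itself becomes the quoted constant.\<close>

definition writer_prog :: prog where
  "writer_prog =
    Tuple (Quote (Num 9))
      (Tuple (Tuple (Quote (Num 1)) Skip) (Quote (prog_code universal_prog)))"

lemma exec_writer_prog: "exec writer_prog (Pr d (Num n)) (prog_code (output_prog d n))"
  by (rule exec_loop_free) (auto simp: writer_prog_def output_prog_def)

text \<open>Halving removes one digit and lowers the logarithm by at least one.\<close>

lemma length_binary: "n \<ge> 1 \<Longrightarrow> real (length (binary n)) \<le> 1 + log 2 (real n)"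
proof (induction n rule: less_induct)
  case (less n)
  show ?case
  proof (cases "n < 2")
    case True
    with less.prems show ?thesis by (subst binary.simps) (auto simp: not_le)
  next
    case False
    have "real (length (binary n)) = real (length (binary (n div 2))) + 1"
      using False by (subst binary.simps) simp
    also have "\<dots> \<le> 1 + log 2 (real (n div 2)) + 1"
      using less.IH[of "n div 2"] False by simp
    finally have "real (length (binary n)) \<le> 1 + log 2 (real (n div 2)) + 1" .
    moreover have "real (n div 2) \<le> real n / 2"
      using real_of_nat_div[of 2] by linarith
    then have "log 2 (real (n div 2)) \<le> log 2 (real n / 2)"
      using False by (subst log_le_cancel_iff) auto
    moreover have "log 2 (real n / 2) = log 2 (real n) - 1"
      using False by (simp add: log_divide)
    ultimately show ?thesis by simp
  qed
qed

lemma prog_length_output_prog: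
  "(\<lambda>n. real (prog_length (output_prog d n))) \<in> O(\<lambda>n. ln (real n))"
proof -
  \<comment> \<open>The length for \<open>n = 0\<close> already counts one digit, so adding all of
    \<open>binary n\<close> gives an upper bound.\<close>
  define c where "c = prog_length (output_prog d 0)"
  have len: "prog_length (output_prog d n) \<le> c + length (binary n)" for n
    by (simp add: c_def prog_length_def output_prog_def)
  have "real (prog_length (output_prog d n)) \<le> (real c + 1 + 1 / ln 2) * ln (real n)"
    if n: "n \<ge> 3" for n
  proof -
    \<comment> \<open>From 3 on, \<open>ln n\<close> is at least 1 and absorbs the additive
      constant.\<close>
    have "exp 1 \<le> real n"
      by (rule order_trans[OF exp_le]) (use n in simp)
    then have ln: "1 \<le> ln (real n)"
      using n by (subst ln_ge_iff) auto
    have "real (prog_length (output_prog d n)) \<le> real c + (1 + log 2 (real n))"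
      using len[of n] length_binary[of n] n by linarith
    also have "\<dots> = (real c + 1) * 1 + 1 / ln 2 * ln (real n)"
      by (simp add: log_def)
    also have "\<dots> \<le> (real c + 1) * ln (real n) + 1 / ln 2 * ln (real n)"
      using ln by (intro add_right_mono mult_left_mono) auto
    finally show ?thesis by (simp add: algebra_simps)
  qed
  then show ?thesis
    by (intro bigoI[of _ "real c + 1 + 1 / ln 2"] eventually_sequentiallyI[of 3]) auto
qed

text \<open>Explicitness is rendered by choosing \<open>writer\<close> before \<open>L\<close> and
  \<open>A\<close>: one program writes all the others. If no output is provable, the answer 0 is
  agreed upon.\<close>

theorem theoremC5:
  shows "\<exists>writer. \<forall>(L :: 'd formal_language) A \<nu> T F H rd.
    formal_language L \<and> axiom_system A \<and> valid_system L A \<and>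
    interprets_gnt L \<nu> T F \<and> expresses_halting H \<and> reads_halting L (F \<circ> H) rd \<longrightarrow>
    (\<exists>P :: nat \<Rightarrow> prog.
       (\<forall>n. exec writer (Pr (description L A rd) (Num n)) (prog_code (P n))) \<and>
       (\<lambda>n. real (prog_length (P n))) \<in> O(\<lambda>n. ln (real n)) \<and>
       (\<forall>n. let S = provable_outputs L A (F \<circ> H) n in
          finite S \<and> outputs (P n) (if S = {} then 0 else Max S)))"
proof (intro exI[of _ writer_prog] allI impI)
  fix L :: "'d formal_language" and A \<nu> T F H rd
  assume *: "formal_language L \<and> axiom_system A \<and> valid_system L A \<and>
    interprets_gnt L \<nu> T F \<and> expresses_halting H \<and> reads_halting L (F \<circ> H) rd"
  let ?d = "description L A rd"
  \<comment> \<open>Validity makes the proved sentence hold in \<open>L\<close>, the interpretation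
    makes \<open>H \<alpha>\<close> true of the numbers, and that truth means halting.\<close>
  have halts: "halts \<alpha>" if "is_proof_of L A ss ((F \<circ> H) \<alpha>)" for \<alpha> ss
    using * that unfolding valid_system_def interprets_gnt_def expresses_halting_def by auto
  have "finite S \<and> outputs (output_prog ?d n) (if S = {} then 0 else Max S)"
    if S: "S = provable_outputs L A (F \<circ> H) n" for S n
  proof -
    have fin: "finite S"
      unfolding S by (rule exec_universal_prog(1)[of L A "F \<circ> H" rd]) (use * halts in blast)+
    have "exec universal_prog (Pr ?d (Num n)) (Num (Max (insert 0 S)))"
      unfolding S by (rule exec_universal_prog(2)) (use * halts in blast)+
    \<comment> \<open>0 is the least natural number, so inserting it changes the maximum of no
      nonempty set.\<close>
    moreover have "Max (insert 0 S) = (if S = {} then 0 else Max S)"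
      using fin by simp
    ultimately have "exec universal_prog (Pr ?d (Num n)) (Num (if S = {} then 0 else Max S))"
      by (simp only:)
    with fin show ?thesis
      unfolding outputs_def output_prog_def by (intro conjI exec_Seq[OF exec_Quote])
  qed
  then show "\<exists>P :: nat \<Rightarrow> prog.
       (\<forall>n. exec writer_prog (Pr ?d (Num n)) (prog_code (P n))) \<and>
       (\<lambda>n. real (prog_length (P n))) \<in> O(\<lambda>n. ln (real n)) \<and>
       (\<forall>n. let S = provable_outputs L A (F \<circ> H) n in
          finite S \<and> outputs (P n) (if S = {} then 0 else Max S))"
    using exec_writer_prog prog_length_output_prog
    by (intro exI[of _ "output_prog ?d"]) (auto simp: Let_def)
qed

end
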